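(* Let $(\phi_t)$ be a parabolic semigroup of positive hyperbolic step in $\mathbb{D}$ whose Koenigs domain $\Omega$ is contained in the upper half-plane $S(0,\pi)$, and let $(T_t)$ be the induced semigroup of composition operators on the Dirichlet space $\mathcal{D}$. Let $\sigma_{\mathcal{D}}$ be the point spectrum of the infinitesimal generator of $(T_t)$, and let $\theta_\Omega$, $\Theta_\Omega$ be the inner and outer arguments of $(\phi_t)$. Then: (a) If $\theta_\Omega=\Theta_\Omega=0$, then $\sigma_{\mathcal{D}}=iS(0,\pi)\cup\{0\}$. (b) If $\theta_\Omega=\Theta_\Omega\in(0,\pi)$, then $iS(0,\pi-\theta_\Omega)\cup\{0\}\subseteq\sigma_{\mathcal{D}}\subseteq iS(0,\pi-\theta_\Omega]\cup\{0\}$. (c) If $\theta_\Omega=\Theta_\Omega=\pi$, then $\sigma_{\mathcal{D}}=\{0\}$. (d) If $\theta_\Omega<\Theta_\Omega$, then $iS(0,\pi-\Theta_\Omega)\cup\{0\}\subseteq\sigma_{\mathcal{D}}\subseteq iS(0,\pi-\theta_\Omega]\cup\{0\}$, where in case $\Theta_\Omega=\pi$ the set on the left is replaced by $\{0\}$, and in case $\theta_\Omega=0$ the set on the right is replaced by $iS(0,\pi)\cup\{0\}$.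
   Context: $\mathbb{D}$ is the open unit disk. A semigroup in $\mathbb{D}$ is a family $(\phi_t)_{t\ge0}$ of holomorphic maps $\phi_t:\mathbb{D}\to\mathbb{D}$ with $\phi_0=\mathrm{id}$, $\phi_{t+s}=\phi_t\circ\phi_s$ for all $t,s\ge0$, and $\phi_t(z)\to z$ uniformly on compacta as $t\to0^+$. It is non-elliptic if there is $\tau\in\partial\mathbb{D}$ (the Denjoy–Wolff point) with $\phi_t(z)\to\tau$ as $t\to+\infty$ for all $z\in\mathbb{D}$; a non-elliptic semigroup is parabolic if the angular derivative satisfies $\phi_1'(\tau)=1$. For a non-elliptic semigroup there is a univalent map $h:\mathbb{D}\to\mathbb{C}$, unique up to translation, the Koenigs function, with $h(\phi_t(z))=h(z)+t$ for all $t\ge0$, $z\in\mathbb{D}$; $\Omega:=h(\mathbb{D})$ is the Koenigs domain. A parabolic semigroup is of positive hyperbolic step if $\Omega$ is contained in a horizontal half-plane, i.e. a half-plane $\{\mathrm{Im}\,w>c\}$ or $\{\mathrm{Im}\,w<c\}$. For $a<b$ in $[-\pi,\pi]$: $S(a,b)=\{w\in\mathbb{C}:a<\arg w<b\}$, $S(a,b]=\{w\in\mathbb{C}:a<\arg w\le b\}$; $iE=\{iw:w\in E\}$. Inner argument: $\theta_\Omega=\sup\left(\{0\}\cup\{\theta\in(0,\pi]:\exists\,q_\theta\in\mathbb{C}\text{ with }q_\theta+S(0,\theta)\subseteq\Omega\}\right)$. Outer argument: $\Theta_\Omega=\inf\{\theta\in(0,\pi]:\exists\,q_\theta\in\mathbb{C}\text{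 with }\Omega\subseteq q_\theta+S(0,\theta)\}$. The Dirichlet space $\mathcal{D}$ is the space of holomorphic $f:\mathbb{D}\to\mathbb{C}$ with $\int_{\mathbb{D}}|f'(z)|^2\,dA(z)<+\infty$ ($dA$ normalized area measure), with its usual norm. $T_t(f)=f\circ\phi_t$, $f\in\mathcal{D}$, is a strongly continuous semigroup of bounded operators; its infinitesimal generator is $\Gamma_{\mathcal{D}}(f)=\lim_{t\to0^+}(T_t(f)-f)/t$ (norm limit), defined on those $f\in\mathcal{D}$ for which the limit exists in $\mathcal{D}$. The point spectrum is the set of eigenvalues $\lambda\in\mathbb{C}$ of $\Gamma_{\mathcal{D}}$. *)

theory Defs
  imports "HOL-Complex_Analysis.Complex_Analysis"
begin

abbreviation unit_disk :: "complex set" ("\<bbbD>") where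
  "\<bbbD> \<equiv> ball 0 1"

section \<open>Semigroups of holomorphic self-maps of the disk\<close>

text \<open>Only the values \<open>\<phi> t z\<close> with \<open>t \<ge> 0\<close> and \<open>z \<in> \<bbbD>\<close> are constrained.\<close>

definition disk_semigroup :: "(real \<Rightarrow> complex \<Rightarrow> complex) \<Rightarrow> bool" where
  "disk_semigroup \<phi> \<longleftrightarrow>
     (\<forall>t\<ge>0. \<phi> t holomorphic_on \<bbbD> \<and> \<phi> t ` \<bbbD> \<subseteq> \<bbbD>) \<and>
     (\<forall>z\<in>\<bbbD>. \<phi> 0 z = z) \<and>
     (\<forall>t\<ge>0. \<forall>s\<ge>0. \<forall>z\<in>\<bbbD>. \<phi> (t + s) z = \<phi> t (\<phi> s z)) \<and>
     (\<forall>K. compact K \<and> K \<subseteq> \<bbbD> \<longrightarrow> uniform_limit K \<phi> (\<lambda>z. z) (at_right 0))"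

definition denjoy_wolff_point :: "(real \<Rightarrow> complex \<Rightarrow> complex) \<Rightarrow> complex \<Rightarrow> bool" where
  "denjoy_wolff_point \<phi> \<tau> \<longleftrightarrow>
     norm \<tau> = 1 \<and> (\<forall>z\<in>\<bbbD>. ((\<lambda>t. \<phi> t z) \<longlongrightarrow> \<tau>) at_top)"

definition non_elliptic :: "(real \<Rightarrow> complex \<Rightarrow> complex) \<Rightarrow> bool" where
  "non_elliptic \<phi> \<longleftrightarrow> disk_semigroup \<phi> \<and> (\<exists>\<tau>. denjoy_wolff_point \<phi> \<tau>)"

text \<open>
  Angular (non-tangential) limits are limits within every Stolz region; the region is empty,
  and so imposes no condition, when \<open>M \<le> 1\<close>.
\<close>

definition stolz_region :: "complex \<Rightarrow> real \<Rightarrow> complex set" where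
  "stolz_region p M = {z \<in> \<bbbD>. norm (z - p) < M * (1 - norm z)}"

definition has_angular_limit :: "(complex \<Rightarrow> complex) \<Rightarrow> complex \<Rightarrow> complex \<Rightarrow> bool" where
  "has_angular_limit f p l \<longleftrightarrow> (\<forall>M. (f \<longlongrightarrow> l) (at p within stolz_region p M))"

definition has_angular_derivative :: "(complex \<Rightarrow> complex) \<Rightarrow> complex \<Rightarrow> complex \<Rightarrow> bool" where
  "has_angular_derivative f p d \<longleftrightarrow>
     (\<exists>q. has_angular_limit f p q \<and> has_angular_limit (\<lambda>z. (f z - q) / (z - p)) p d)"

definition parabolic :: "(real \<Rightarrow> complex \<Rightarrow> complex) \<Rightarrow> bool" where
  "parabolic \<phi> \<longleftrightarrow>
     non_elliptic \<phi> \<and> (\<exists>\<tau>. denjoy_wolff_point \<phi> \<tau> \<and> has_angular_derivative (\<phi> 1) \<tau> 1)"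

text \<open>
  The Koenigs function is unique only up to translation, so it is a predicate on \<open>h\<close>; the
  Koenigs domain is \<open>h ` \<bbbD>\<close>.
\<close>

definition koenigs_function :: "(real \<Rightarrow> complex \<Rightarrow> complex) \<Rightarrow> (complex \<Rightarrow> complex) \<Rightarrow> bool" where
  "koenigs_function \<phi> h \<longleftrightarrow>
     h holomorphic_on \<bbbD> \<and> inj_on h \<bbbD> \<and>
     (\<forall>t\<ge>0. \<forall>z\<in>\<bbbD>. h (\<phi> t z) = h z + of_real t)"

definition positive_hyperbolic_step :: "(real \<Rightarrow> complex \<Rightarrow> complex) \<Rightarrow> bool" where
  "positive_hyperbolic_step \<phi> \<longleftrightarrow>
     (\<exists>h c. koenigs_function \<phi> h \<and>
        (h ` \<bbbD> \<subseteq> {w. Im w > c} \<or> h ` \<bbbD> \<subseteq> {w. Im w < c}))"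

section \<open>Sectors, inner and outer argument\<close>

text \<open>
  \<open>Arg\<close> takes values in \<open>(-\<pi>, \<pi>]\<close> and \<open>Arg 0 = 0\<close> by convention, so the vertex has to be
  excluded explicitly.
\<close>

definition sector_oo :: "real \<Rightarrow> real \<Rightarrow> complex set" where
  "sector_oo a b = {w. w \<noteq> 0 \<and> a < Arg w \<and> Arg w < b}"

definition sector_oc :: "real \<Rightarrow> real \<Rightarrow> complex set" where
  "sector_oc a b = {w. w \<noteq> 0 \<and> a < Arg w \<and> Arg w \<le> b}"

definition inner_argument :: "complex set \<Rightarrow> real" where
  "inner_argument \<Omega> =
     Sup ({0} \<union> {\<theta>. 0 < \<theta> \<and> \<theta> \<le> pi \<and> (\<exists>q. (+) q ` sector_oo 0 \<theta> \<subseteq> \<Omega>)})"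

text \<open>The infimum is over a nonempty set whenever \<open>\<Omega>\<close> lies in a half-plane \<open>{Im w > c}\<close>.\<close>

definition outer_argument :: "complex set \<Rightarrow> real" where
  "outer_argument \<Omega> =
     Inf {\<theta>. 0 < \<theta> \<and> \<theta> \<le> pi \<and> (\<exists>q. \<Omega> \<subseteq> (+) q ` sector_oo 0 \<theta>)}"

section \<open>The Dirichlet space and the generator of the composition semigroup\<close>

text \<open>
  Elements of the Dirichlet space are represented by functions on all of \<open>\<complex>\<close>, of which only
  the restriction to \<open>\<bbbD>\<close> matters: equality of elements is equality on \<open>\<bbbD>\<close>.
\<close>

definition dirichlet_space :: "(complex \<Rightarrow> complex) set" where
  "dirichlet_space =
     {f. f holomorphic_on \<bbbD> \<and> set_integrable lborel \<bbbD> (\<lambda>z. (norm (deriv f z))\<^sup>2)}"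

definition dirichlet_norm :: "(complex \<Rightarrow> complex) \<Rightarrow> real" where
  "dirichlet_norm f =
     sqrt ((norm (f 0))\<^sup>2 + (LINT z:\<bbbD>|lborel. (norm (deriv f z))\<^sup>2) / pi)"

text \<open>
  Norm convergence in the Dirichlet space. Membership of \<open>u t\<close> is required because the
  integral in \<open>dirichlet_norm\<close> is \<open>0\<close> by convention for non-integrable functions.
\<close>

definition dirichlet_tendsto ::
    "('a \<Rightarrow> complex \<Rightarrow> complex) \<Rightarrow> (complex \<Rightarrow> complex) \<Rightarrow> 'a filter \<Rightarrow> bool" where
  "dirichlet_tendsto u g F \<longleftrightarrow>
     g \<in> dirichlet_space \<and> (\<forall>\<^sub>F t in F. u t \<in> dirichlet_space) \<and>
     ((\<lambda>t. dirichlet_norm (\<lambda>z. u t z - g z)) \<longlongrightarrow> 0) F"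

definition comp_op ::
    "(real \<Rightarrow> complex \<Rightarrow> complex) \<Rightarrow> real \<Rightarrow> (complex \<Rightarrow> complex) \<Rightarrow> complex \<Rightarrow> complex" where
  "comp_op \<phi> t f = f \<circ> \<phi> t"

text \<open>
  The graph of the (unbounded) infinitesimal generator: \<open>f\<close> lies in its domain and is mapped
  to \<open>g\<close>.
\<close>

definition generator_graph ::
    "(real \<Rightarrow> complex \<Rightarrow> complex) \<Rightarrow> (complex \<Rightarrow> complex) \<Rightarrow> (complex \<Rightarrow> complex) \<Rightarrow> bool" where
  "generator_graph \<phi> f g \<longleftrightarrow>
     f \<in> dirichlet_space \<and>
     dirichlet_tendsto (\<lambda>t z. (comp_op \<phi> t f z - f z) / of_real t) g (at_right 0)"

definition point_spectrum :: "(real \<Rightarrow> complex \<Rightarrow> complex) \<Rightarrow> complex set" where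
  "point_spectrum \<phi> =
     {\<mu>. \<exists>f. (\<exists>z\<in>\<bbbD>. f z \<noteq> 0) \<and> generator_graph \<phi> f (\<lambda>z. \<mu> * f z)}"

end

theory Submission
  imports Defs
begin

text \<open>
  The eigenvalue equation for the generator is, in the Koenigs coordinate \<open>w = h z\<close>, the
  ordinary differential equation \<open>F' = \<lambda> F\<close>, because there \<open>\<phi> t\<close> is the translation by \<open>t\<close>. So the
  only candidate for an eigenfunction is \<open>exp (\<lambda> h)\<close>, and \<open>\<lambda> \<noteq> 0\<close> is an eigenvalue exactly when this
  function has finite Dirichlet integral. As \<open>h\<close> is univalent, the change of variables \<open>w = h z\<close>
  turns that integral into \<open>\<bar>\<lambda>\<bar>\<^sup>2\<close> times the integral of \<open>exp (2 Re (\<lambda> w))\<close> over \<open>\<Omega>\<close>; this is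
  \<open>point_spectrum_iff_integrable\<close>. What is left is to decide when an exponential is integrable on
  a planar domain. Write \<open>\<lambda> = \<i> \<mu>\<close>, so that the integrand is \<open>exp (-2 Im (\<mu> w))\<close>.

  If \<open>\<Omega>\<close> lies in a translate of \<open>S(0,\<theta>)\<close> and \<open>0 < Arg \<mu>\<close>, \<open>Arg \<mu> + \<theta> < \<pi>\<close>, then multiplication by \<open>\<mu>\<close>
  maps \<open>S(0,\<theta>)\<close> to a sector in the upper half-plane whose closure meets the real axis only at the
  vertex, so the integrand decays exponentially in the distance to the vertex (\<open>set_integrable_exp_on_sector\<close>). Taking \<open>\<theta>\<close> close to
  the outer argument gives the lower inclusions.

  Conversely, if \<open>\<Omega>\<close> contains a disc and its equally spaced translates in a direction \<open>e\<close>, then the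
  integrand must decay in that direction, that is, \<open>Im (\<mu> e) > 0\<close>; otherwise it is bounded below on
  infinitely many disjoint discs of the same size (\<open>Im_pos_of_set_integrable_exp\<close>). The domain \<open>\<Omega>\<close> is
  invariant under translation to the right, which gives \<open>Im \<mu> > 0\<close>; and a sector \<open>q + S(0,\<theta>)\<close>
  inside \<open>\<Omega>\<close> gives \<open>Im (\<mu> e\<^sup>i\<^sup>\<alpha>) > 0\<close> for all \<open>0 < \<alpha> < \<theta>\<close>, hence \<open>Arg \<mu> + \<theta> \<le> \<pi>\<close>. Taking the supremum over
  \<open>\<theta>\<close> gives the upper inclusions.
\<close>

section \<open>Area change of variables under univalent maps\<close>

text \<open>
  The change of variables formula for several real variables is stated on \<open>real ^ 'n\<close>. The
  following maps identify \<open>\<complex>\<close> with \<open>real ^ 2\<close> and preserve Lebesgue measure.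
\<close>

definition complex_of_vec2 :: "real^2 \<Rightarrow> complex" where
  "complex_of_vec2 v = Complex (v $ 1) (v $ 2)"

definition vec2_of_complex :: "complex \<Rightarrow> real^2" where
  "vec2_of_complex z = vector [Re z, Im z]"

lemma complex_of_vec2_inverse [simp]:
  "complex_of_vec2 (vec2_of_complex z) = z" "vec2_of_complex (complex_of_vec2 v) = v"
  by (simp_all add: complex_of_vec2_def vec2_of_complex_def vec_eq_iff forall_2)

lemma vec2_of_complex_nth [simp]:
  "vec2_of_complex z $ 1 = Re z" "vec2_of_complex z $ 2 = Im z"
  by (simp_all add: vec2_of_complex_def)

lemma complex_of_vec2_sel [simp]: "Re (complex_of_vec2 v) = v $ 1" "Im (complex_of_vec2 v) = v $ 2"
  by (simp_all add: complex_of_vec2_def)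

lemma bounded_linear_complex_of_vec2: "bounded_linear complex_of_vec2"
  by (rule linear_conv_bounded_linear[THEN iffD1], rule linearI) (auto simp: complex_eq_iff)

lemma bounded_linear_vec2_of_complex: "bounded_linear vec2_of_complex"
  by (rule linear_conv_bounded_linear[THEN iffD1], rule linearI)
    (auto simp: vec_eq_iff forall_2)

lemma borel_measurable_complex_of_vec2 [measurable]: "complex_of_vec2 \<in> borel_measurable borel"
  by (intro borel_measurable_continuous_onI linear_continuous_on bounded_linear_complex_of_vec2)

lemma lborel_distr_complex_of_vec2: "distr lborel borel complex_of_vec2 = lborel"
proof (rule lborel_eqI[symmetric])
  fix l u :: complex
  assume le: "\<And>b. b \<in> Basis \<Longrightarrow> l \<bullet> b \<le> u \<bullet> b"
  have vimage: "complex_of_vec2 -` box l u = box (vec2_of_complex l) (vec2_of_complex u)"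
    by (auto simp: box_def Basis_complex_def Basis_vec_def UNIV_2 cart_eq_inner_axis[symmetric]
      inner_complex_def)
  have bas: "Basis = {axis 1 1, axis 2 (1::real) :: real^2}"
    by (auto simp: Basis_vec_def UNIV_2)
  have ne: "axis 1 1 \<noteq> (axis 2 (1::real) :: real^2)" by (simp add: axis_eq_axis)
  have "emeasure (distr lborel borel complex_of_vec2) (box l u)
      = emeasure lborel (box (vec2_of_complex l) (vec2_of_complex u))"
    by (subst emeasure_distr) (auto simp: vimage)
  also have "\<dots> = (\<Prod>b\<in>Basis. (u - l) \<bullet> b)"
    using le[of 1] le[of \<i>] ne
    by (subst emeasure_lborel_box)
      (auto simp: bas Basis_complex_def inner_complex_def cart_eq_inner_axis[symmetric])
  finally show "emeasure (distr lborel borel complex_of_vec2) (box l u) = (\<Prod>b\<in>Basis. (u - l) \<bullet> b)" .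
qed simp

lemma integrable_lborel_complex_of_vec2_iff:
  fixes f :: "complex \<Rightarrow> real"
  assumes "f \<in> borel_measurable borel"
  shows "integrable lborel f \<longleftrightarrow> integrable lborel (\<lambda>v. f (complex_of_vec2 v))"
  using integrable_distr_eq[of complex_of_vec2 lborel borel f] assms
  by (simp add: lborel_distr_complex_of_vec2)

lemma vimage_complex_of_vec2: "complex_of_vec2 -` S = vec2_of_complex ` S"
  by (auto simp: image_iff) (metis complex_of_vec2_inverse(2))

lemma absolutely_integrable_complex_of_vec2_iff:
  fixes f :: "complex \<Rightarrow> real"
  assumes "open S" "continuous_on S f"
  shows "set_integrable lborel S f \<longleftrightarrow> (\<lambda>v. f (complex_of_vec2 v)) absolutely_integrable_on (vec2_of_complex ` S)"
proof -
  have meas [measurable]: "(\<lambda>z. indicator S z * f z) \<in> borel_measurable borel"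
    using borel_measurable_continuous_on_indicator[of S f] assms by simp
  have [measurable]: "(\<lambda>v. indicator S (complex_of_vec2 v) * f (complex_of_vec2 v)) \<in> borel_measurable borel"
    by (rule measurable_compose[OF borel_measurable_complex_of_vec2 meas])
  have ind: "indicator (vec2_of_complex ` S) v = (indicator S (complex_of_vec2 v) :: real)" for v
    by (auto simp: indicator_def vimage_complex_of_vec2[symmetric])
  show ?thesis
    by (simp add: set_integrable_def ind integrable_completion integrable_lborel_complex_of_vec2_iff)
qed

text \<open>
  The real derivative of \<open>h\<close> at \<open>z\<close> is multiplication by \<open>h' z\<close>, whose matrix
  \<open>((a, -b), (b, a))\<close> has determinant \<open>a\<^sup>2 + b\<^sup>2\<close>, the square of the modulus of \<open>h' z\<close>.
\<close>

lemma set_integrable_holomorphic_change_of_variables: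
  fixes h :: "complex \<Rightarrow> complex" and F :: "complex \<Rightarrow> real"
  assumes S: "open S" and h: "h holomorphic_on S" "inj_on h S" and F: "continuous_on (h ` S) F"
  shows "set_integrable lborel (h ` S) F \<longleftrightarrow> set_integrable lborel S (\<lambda>z. (norm (deriv h z))\<^sup>2 * F (h z))"
proof -
  define g where "g = vec2_of_complex \<circ> h \<circ> complex_of_vec2"
  define g' where "g' v = vec2_of_complex \<circ> (\<lambda>w. deriv h (complex_of_vec2 v) * w) \<circ> complex_of_vec2" for v
  define U where "U = vec2_of_complex ` S"
  have opU: "open U"
    unfolding U_def vimage_complex_of_vec2[symmetric]
    by (intro open_vimage S linear_continuous_on bounded_linear_complex_of_vec2)
  have der: "(g has_derivative g' v) (at v within U)" if "v \<in> U" for v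
    unfolding g_def g'_def
  proof (intro diff_chain_within)
    show "(complex_of_vec2 has_derivative complex_of_vec2) (at v within U)"
      by (rule bounded_linear_imp_has_derivative[OF bounded_linear_complex_of_vec2])
    show "(vec2_of_complex has_derivative vec2_of_complex) (at (h (complex_of_vec2 v)) within h ` complex_of_vec2 ` U)"
      by (rule bounded_linear_imp_has_derivative[OF bounded_linear_vec2_of_complex])
    have "complex_of_vec2 v \<in> S" using that by (auto simp: U_def)
    then have "(h has_field_derivative deriv h (complex_of_vec2 v)) (at (complex_of_vec2 v))"
      using h S holomorphic_derivI by blast
    then show "(h has_derivative (*) (deriv h (complex_of_vec2 v))) (at (complex_of_vec2 v) within complex_of_vec2 ` U)"
      by (auto simp: has_field_derivative_def intro: has_derivative_at_withinI)
  qed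
  have inj: "inj_on g U"
    using h(2) by (auto simp: inj_on_def g_def U_def) (metis complex_of_vec2_inverse(1))
  have det: "\<bar>det (matrix (g' v))\<bar> = (norm (deriv h (complex_of_vec2 v)))\<^sup>2" for v
    unfolding cmod_power2 by (simp add: det_2 matrix_def g'_def axis_def power2_eq_square)
  have gU: "g ` U = vec2_of_complex ` (h ` S)"
    by (auto simp: g_def U_def image_iff)
  have "set_integrable lborel (h ` S) F \<longleftrightarrow> (\<lambda>v. F (complex_of_vec2 v)) absolutely_integrable_on (g ` U)"
    unfolding gU by (intro absolutely_integrable_complex_of_vec2_iff F open_mapping_thm3[OF h(1) S h(2)])
  also have "\<dots> \<longleftrightarrow> (\<lambda>v. vec (F (complex_of_vec2 v)) :: real^1) absolutely_integrable_on (g ` U)"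
    by (simp add: absolutely_integrable_on_1_iff)
  also have "\<dots> \<longleftrightarrow> (\<lambda>v. \<bar>det (matrix (g' v))\<bar> *\<^sub>R (vec (F (complex_of_vec2 (g v))) :: real^1)) absolutely_integrable_on U"
    using opU by (intro absolutely_integrable_change_of_variables der inj) auto
  also have "\<dots> \<longleftrightarrow> (\<lambda>v. (norm (deriv h (complex_of_vec2 v)))\<^sup>2 * F (h (complex_of_vec2 v))) absolutely_integrable_on U"
    by (simp add: absolutely_integrable_on_1_iff det g_def)
  also have "\<dots> \<longleftrightarrow> set_integrable lborel S (\<lambda>z. (norm (deriv h z))\<^sup>2 * F (h z))"
    unfolding U_def
  proof (intro absolutely_integrable_complex_of_vec2_iff[symmetric] S continuous_intros)
    show "continuous_on S (deriv h)"
      using h S by (intro holomorphic_on_imp_continuous_on holomorphic_deriv) auto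
    show "continuous_on S (\<lambda>z. F (h z))"
      using continuous_on_compose2[OF F holomorphic_on_imp_continuous_on[OF h(1)]] by auto
  qed
  finally show ?thesis .
qed

section \<open>The point spectrum as an integrability condition\<close>

lemma koenigs_function_properties:
  assumes "koenigs_function \<phi> h"
  shows "h holomorphic_on \<bbbD>" "inj_on h \<bbbD>" "open (h ` \<bbbD>)" "connected (h ` \<bbbD>)"
  using assms open_mapping_thm3[of h \<bbbD>]
  by (auto simp: koenigs_function_def intro!: connected_continuous_image holomorphic_on_imp_continuous_on)

text \<open>
  The Koenigs domain is starlike at infinity.
\<close>

lemma koenigs_domain_translate:
  assumes "disk_semigroup \<phi>" "koenigs_function \<phi> h" "w \<in> h ` \<bbbD>" "t \<ge> 0"
  shows "w + of_real t \<in> h ` \<bbbD>"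
proof -
  obtain z where z: "z \<in> \<bbbD>" "w = h z" using assms by auto
  moreover have "\<phi> t z \<in> \<bbbD>" using assms z unfolding disk_semigroup_def by blast
  moreover have "h (\<phi> t z) = w + of_real t" using assms z by (auto simp: koenigs_function_def)
  ultimately show ?thesis by (metis imageI)
qed

lemma dirichlet_space_diff:
  assumes f: "f \<in> dirichlet_space" and g: "g \<in> dirichlet_space"
  shows "(\<lambda>z. f z - g z) \<in> dirichlet_space"
proof -
  have hol: "f holomorphic_on \<bbbD>" "g holomorphic_on \<bbbD>"
    and int: "set_integrable lborel \<bbbD> (\<lambda>z. (norm (deriv f z))\<^sup>2)"
      "set_integrable lborel \<bbbD> (\<lambda>z. (norm (deriv g z))\<^sup>2)"
    using f g by (auto simp: dirichlet_space_def)
  have der: "deriv (\<lambda>z. f z - g z) z = deriv f z - deriv g z" if "z \<in> \<bbbD>" for z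
    using hol that by (intro deriv_diff) (auto intro: holomorphic_on_imp_differentiable_at[of _ \<bbbD>])
  have hd: "(\<lambda>z. f z - g z) holomorphic_on \<bbbD>" using hol by (intro holomorphic_intros)
  then have "continuous_on \<bbbD> (\<lambda>z. (norm (deriv (\<lambda>z. f z - g z) z))\<^sup>2)"
    by (intro continuous_intros holomorphic_on_imp_continuous_on holomorphic_deriv) auto
  then have meas: "set_borel_measurable lborel \<bbbD> (\<lambda>z. (norm (deriv (\<lambda>z. f z - g z) z))\<^sup>2)"
    by (simp add: set_borel_measurable_def borel_measurable_continuous_on_indicator
        del: real_scaleR_def)
  have "set_integrable lborel \<bbbD> (\<lambda>z. 2 * (norm (deriv f z))\<^sup>2 + 2 * (norm (deriv g z))\<^sup>2)"
    using int by (intro set_integral_add) auto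
  then have "set_integrable lborel \<bbbD> (\<lambda>z. (norm (deriv (\<lambda>z. f z - g z) z))\<^sup>2)"
  proof (rule set_integrable_bound[OF _ meas], intro AE_I2 impI)
    fix z assume "z \<in> \<bbbD>"
    have "(norm (deriv f z - deriv g z))\<^sup>2 \<le> (norm (deriv f z) + norm (deriv g z))\<^sup>2"
      by (intro power_mono norm_triangle_ineq4) auto
    also have "\<dots> \<le> 2 * (norm (deriv f z))\<^sup>2 + 2 * (norm (deriv g z))\<^sup>2"
      using sum_squares_bound[of "norm (deriv f z)" "norm (deriv g z)"]
      by (simp add: power2_sum)
    finally show "norm ((norm (deriv (\<lambda>z. f z - g z) z))\<^sup>2)
        \<le> norm (2 * (norm (deriv f z))\<^sup>2 + 2 * (norm (deriv g z))\<^sup>2)"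
      using der[OF \<open>z \<in> \<bbbD>\<close>] by simp
  qed
  with hd show ?thesis by (simp add: dirichlet_space_def)
qed

lemma dirichlet_norm_lower_bounds:
  assumes "f \<in> dirichlet_space"
  shows "norm (f 0) \<le> dirichlet_norm f"
    and "(\<integral>\<^sup>+z\<in>\<bbbD>. ennreal ((norm (deriv f z))\<^sup>2) \<partial>lborel) \<le> ennreal (pi * (dirichlet_norm f)\<^sup>2)"
proof -
  define I where "I = (LINT z:\<bbbD>|lborel. (norm (deriv f z))\<^sup>2)"
  have I: "I \<ge> 0" unfolding I_def set_lebesgue_integral_def by (intro integral_nonneg_AE) auto
  have eq: "dirichlet_norm f = sqrt ((norm (f 0))\<^sup>2 + I / pi)" by (simp add: dirichlet_norm_def I_def)
  show "norm (f 0) \<le> dirichlet_norm f"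
    unfolding eq using I by (intro real_le_rsqrt) auto
  have "(\<integral>\<^sup>+z\<in>\<bbbD>. ennreal ((norm (deriv f z))\<^sup>2) \<partial>lborel)
     = (\<integral>\<^sup>+z. ennreal (indicator \<bbbD> z * (norm (deriv f z))\<^sup>2) \<partial>lborel)"
    by (intro nn_integral_cong) (auto simp: indicator_def)
  also have "\<dots> = ennreal I"
    using assms unfolding I_def set_lebesgue_integral_def dirichlet_space_def set_integrable_def
    by (subst nn_integral_eq_integral) auto
  also have "\<dots> \<le> ennreal (pi * (dirichlet_norm f)\<^sup>2)"
    unfolding eq using I by (intro ennreal_leI) (auto simp: field_simps)
  finally show "(\<integral>\<^sup>+z\<in>\<bbbD>. ennreal ((norm (deriv f z))\<^sup>2) \<partial>lborel) \<le> ennreal (pi * (dirichlet_norm f)\<^sup>2)" .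
qed

lemma continuous_eq_0_of_null_nn_integral:
  assumes S: "open S" and f: "continuous_on S (f :: complex \<Rightarrow> complex)"
    and null: "(\<integral>\<^sup>+z\<in>S. ennreal ((norm (f z))\<^sup>2) \<partial>lborel) = 0"
    and z: "z \<in> S"
  shows "f z = 0"
proof -
  define N where "N = {z \<in> S. f z \<noteq> 0}"
  have "N = S \<inter> f -` (- {0})" by (auto simp: N_def)
  then have opN: "open N" using continuous_open_preimage[OF f S, of "-{0}"] by auto
  have "continuous_on S (\<lambda>z. (norm (f z))\<^sup>2)" using f by (intro continuous_intros)
  then have [measurable]: "(\<lambda>z. indicator S z *\<^sub>R (norm (f z))\<^sup>2) \<in> borel_measurable borel"
    using S by (intro borel_measurable_continuous_on_indicator) auto
  have "(\<integral>\<^sup>+z\<in>S. ennreal ((norm (f z))\<^sup>2) \<partial>lborel) = (\<integral>\<^sup>+z. ennreal (indicator S z *\<^sub>R (norm (f z))\<^sup>2) \<partial>lborel)"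
    by (intro nn_integral_cong) (auto simp: indicator_def)
  with null have "(\<integral>\<^sup>+z. ennreal (indicator S z *\<^sub>R (norm (f z))\<^sup>2) \<partial>lborel) = 0"
    by simp
  then have "AE z in lborel. ennreal (indicator S z *\<^sub>R (norm (f z))\<^sup>2) = 0"
    by (subst (asm) nn_integral_0_iff_AE) (auto simp del: real_scaleR_def)
  then have ae: "AE z in lborel. z \<notin> N"
    by eventually_elim (auto simp: N_def indicator_def split: if_splits)
  have "N \<in> null_sets lborel"
    using ae opN by (subst (asm) AE_iff_null_sets[symmetric]) auto
  then have "negligible N" by (auto simp: negligible_iff_null_sets intro: null_sets_completionI)
  with opN have "N = {}" using open_not_negligible by blast
  with z show ?thesis by (auto simp: N_def)
qed

lemma dirichlet_scaled:
  assumes f: "f \<in> dirichlet_space" and g: "\<And>z. z \<in> \<bbbD> \<Longrightarrow> g z = c * f z"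
  shows "g \<in> dirichlet_space" and "dirichlet_norm g = norm c * dirichlet_norm f"
proof -
  have hol: "f holomorphic_on \<bbbD>" and int: "set_integrable lborel \<bbbD> (\<lambda>z. (norm (deriv f z))\<^sup>2)"
    using f by (auto simp: dirichlet_space_def)
  have der: "deriv g z = c * deriv f z" if "z \<in> \<bbbD>" for z
  proof -
    have "(f has_field_derivative deriv f z) (at z)"
      using hol that by (intro holomorphic_derivI[of _ \<bbbD>]) auto
    then have "((\<lambda>z. c * f z) has_field_derivative c * deriv f z) (at z)"
      by (rule DERIV_cmult)
    then have "(g has_field_derivative c * deriv f z) (at z)"
      by (rule has_field_derivative_transform_within_open[of _ _ _ \<bbbD>]) (use that g in auto)
    then show ?thesis by (rule DERIV_imp_deriv)
  qed
  have nder: "indicator \<bbbD> z * (norm (deriv g z))\<^sup>2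
      = (norm c)\<^sup>2 * (indicator \<bbbD> z * (norm (deriv f z))\<^sup>2)" for z
    by (auto simp: indicator_def der norm_mult power_mult_distrib)
  have "(\<lambda>z. c * f z) holomorphic_on \<bbbD>" using hol by (intro holomorphic_intros)
  then have "g holomorphic_on \<bbbD>" using g by (subst holomorphic_cong[OF refl, of _ _ "\<lambda>z. c * f z"]) auto
  moreover have "set_integrable lborel \<bbbD> (\<lambda>z. (norm (deriv g z))\<^sup>2)"
    using int unfolding set_integrable_def by (simp add: nder)
  ultimately show "g \<in> dirichlet_space" by (simp add: dirichlet_space_def)
  have "(LINT z:\<bbbD>|lborel. (norm (deriv g z))\<^sup>2) = (norm c)\<^sup>2 * (LINT z:\<bbbD>|lborel. (norm (deriv f z))\<^sup>2)"
    unfolding set_lebesgue_integral_def by (simp add: nder)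
  then have "dirichlet_norm g = sqrt ((norm c)\<^sup>2 * ((norm (f 0))\<^sup>2 + (LINT z:\<bbbD>|lborel. (norm (deriv f z))\<^sup>2) / pi))"
    using g[of 0] by (simp add: dirichlet_norm_def norm_mult power_mult_distrib algebra_simps)
  then show "dirichlet_norm g = norm c * dirichlet_norm f"
    by (simp add: real_sqrt_mult dirichlet_norm_def)
qed

lemma difference_quotient_tendsto_at_right:
  assumes "G holomorphic_on U" "open U" "w \<in> U"
  shows "((\<lambda>t. (G (w + of_real t) - G w) / of_real t) \<longlongrightarrow> deriv G w) (at_right 0)"
proof -
  have "(G has_field_derivative deriv G w) (at w)" by (rule holomorphic_derivI[OF assms])
  then have "((\<lambda>k. (G (w + k) - G w) / k) \<longlongrightarrow> deriv G w) (at 0)"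
    by (simp add: DERIV_def)
  moreover have "filterlim (complex_of_real) (at 0) (at_right 0)"
    unfolding filterlim_at
  proof
    show "\<forall>\<^sub>F t in at_right 0. complex_of_real t \<in> UNIV \<and> complex_of_real t \<noteq> 0"
      using eventually_at_right_less[of "0::real"] by eventually_elim simp
    show "(complex_of_real \<longlongrightarrow> 0) (at_right 0)" by (auto intro!: tendsto_eq_intros)
  qed
  ultimately show ?thesis by (rule filterlim_compose)
qed

text \<open>
  Set \<open>F = f \<circ> h\<^sup>-\<^sup>1\<close>. The difference quotient \<open>u t\<close> of the orbit of \<open>f\<close> minus \<open>\<mu> f\<close> tends to
  \<open>v = F' \<circ> h - \<mu> (F \<circ> h)\<close> pointwise on the disk because \<open>F\<close> is differentiable; the
  derivative of \<open>u t\<close> tends to \<open>v'\<close> because \<open>F'\<close> is differentiable as well. By assumption the Dirichlet norm of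
  \<open>u t\<close> tends to \<open>0\<close>. Fatou's lemma then gives \<open>v' = 0\<close>, and the values at the origin give
  \<open>v 0 = 0\<close>; so \<open>v\<close> vanishes, which is the differential equation \<open>F' = \<mu> F\<close>.
\<close>

lemma eigenfunction_is_exp:
  assumes sg: "disk_semigroup \<phi>" and k: "koenigs_function \<phi> h"
    and gen: "generator_graph \<phi> f (\<lambda>z. \<mu> * f z)"
  obtains c where "\<And>z. z \<in> \<bbbD> \<Longrightarrow> f z = c * exp (\<mu> * h z)"
proof -
  define \<Omega> where "\<Omega> = h ` \<bbbD>"
  note kp = koenigs_function_properties[OF k, folded \<Omega>_def]
  have h_in: "h z \<in> \<Omega>" if "z \<in> \<bbbD>" for z using that by (auto simp: \<Omega>_def)
  have trans: "w + of_real t \<in> \<Omega>" if "w \<in> \<Omega>" "t \<ge> 0" for w t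
    using koenigs_domain_translate[OF sg k] that unfolding \<Omega>_def .
  have "\<exists>g. g holomorphic_on \<Omega> \<and> (\<forall>z\<in>\<bbbD>. g (h z) = z)"
    unfolding \<Omega>_def by (rule holomorphic_has_inverse[OF kp(1) open_ball kp(2)]) blast
  then obtain g where g: "g holomorphic_on \<Omega>" "\<And>z. z \<in> \<bbbD> \<Longrightarrow> g (h z) = z" by blast
  have fD: "f \<in> dirichlet_space" using gen by (simp add: generator_graph_def)
  then have fh: "f holomorphic_on \<bbbD>" by (simp add: dirichlet_space_def)
  define F where "F = f \<circ> g"
  have "g ` \<Omega> \<subseteq> \<bbbD>" using g(2) by (auto simp: \<Omega>_def)
  then have F: "F holomorphic_on \<Omega>"
    unfolding F_def using fh g(1) by (intro holomorphic_on_compose_gen[of _ _ _ \<bbbD>])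
  then have F': "deriv F holomorphic_on \<Omega>" using kp(3) by (intro holomorphic_deriv)
  have Fh: "F (h z) = f z" if "z \<in> \<bbbD>" for z using that g(2) by (simp add: F_def)
  have Fphi: "f (\<phi> t z) = F (h z + of_real t)" if "z \<in> \<bbbD>" "t \<ge> 0" for z t
  proof -
    have "\<phi> t z \<in> \<bbbD>" using sg that unfolding disk_semigroup_def by blast
    from Fh[OF this] show ?thesis using k that by (auto simp: koenigs_function_def)
  qed
  define u where "u t z = (comp_op \<phi> t f z - f z) / of_real t - \<mu> * f z" for t z
  define v where "v z = deriv F (h z) - \<mu> * F (h z)" for z
  have u_eq: "u t z = (F (h z + of_real t) - F (h z)) / of_real t - \<mu> * F (h z)"
    if "z \<in> \<bbbD>" "t \<ge> 0" for t z
    using that by (simp add: u_def comp_op_def Fphi Fh)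
  have dF: "(F has_field_derivative deriv F w) (at w)" if "w \<in> \<Omega>" for w
    using F kp(3) that holomorphic_derivI by blast
  have dF': "(deriv F has_field_derivative deriv (deriv F) w) (at w)" if "w \<in> \<Omega>" for w
    using F' kp(3) that holomorphic_derivI by blast
  have dh: "(h has_field_derivative deriv h z) (at z)" if "z \<in> \<bbbD>" for z
    using kp(1) that holomorphic_derivI by blast
  have du: "(u t has_field_derivative
      deriv h z * ((deriv F (h z + of_real t) - deriv F (h z)) / of_real t - \<mu> * deriv F (h z))) (at z)"
    if z: "z \<in> \<bbbD>" and t: "t > 0" for t z
  proof -
    have hz: "h z \<in> \<Omega>" "h z + of_real t \<in> \<Omega>"
      using h_in[OF z] trans[OF h_in[OF z], of t] t by auto
    have "((\<lambda>z. h z + of_real t) has_field_derivative deriv h z) (at z)"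
      using DERIV_add[OF dh[OF z] DERIV_const] by simp
    note c1 = DERIV_chain2[OF dF[OF hz(2)] this] and c2 = DERIV_chain2[OF dF[OF hz(1)] dh[OF z]]
    have "(u t has_field_derivative
      ((deriv F (h z + of_real t) * deriv h z - deriv F (h z) * deriv h z) / of_real t
        - \<mu> * (deriv F (h z) * deriv h z))) (at z)"
      by (rule has_field_derivative_transform_within_open[OF DERIV_diff[OF DERIV_cdivide[OF DERIV_diff[OF c1 c2]]
            DERIV_cmult[OF c2]] open_ball z])
        (use t u_eq in simp)
    moreover have "(deriv F (h z + of_real t) * deriv h z - deriv F (h z) * deriv h z) / of_real t
        - \<mu> * (deriv F (h z) * deriv h z)
      = deriv h z * ((deriv F (h z + of_real t) - deriv F (h z)) / of_real t - \<mu> * deriv F (h z))"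
      using t by (simp add: field_simps)
    ultimately show ?thesis by simp
  qed
  have u_hol: "u t holomorphic_on \<bbbD>" if "t > 0" for t
    unfolding holomorphic_on_open[OF open_ball] using du[OF _ that] by blast
  have dv: "(v has_field_derivative deriv h z * (deriv (deriv F) (h z) - \<mu> * deriv F (h z))) (at z)"
    if z: "z \<in> \<bbbD>" for z
  proof -
    have "(v has_field_derivative deriv (deriv F) (h z) * deriv h z - \<mu> * (deriv F (h z) * deriv h z)) (at z)"
      unfolding v_def
      by (rule DERIV_diff[OF DERIV_chain2[OF dF'[OF h_in[OF z]] dh[OF z]]
            DERIV_cmult[OF DERIV_chain2[OF dF[OF h_in[OF z]] dh[OF z]]]])
    then show ?thesis by (simp add: algebra_simps)
  qed
  have v_hol: "v holomorphic_on \<bbbD>"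
    unfolding holomorphic_on_open[OF open_ball] using dv by blast
  \<comment> \<open>Fatou's lemma works along sequences, so \<open>t\<close> is restricted to \<open>\<tau> n \<down> 0\<close>.\<close>
  define \<tau> where "\<tau> n = inverse (real (Suc n))" for n
  have \<tau>_pos: "\<tau> n > 0" for n by (simp add: \<tau>_def)
  have \<tau>_lim: "filterlim \<tau> (at_right 0) sequentially"
    unfolding \<tau>_def filterlim_at using LIMSEQ_inverse_real_of_nat by auto
  have gen_lim: "dirichlet_tendsto (\<lambda>t z. (comp_op \<phi> t f z - f z) / of_real t) (\<lambda>z. \<mu> * f z) (at_right 0)"
    using gen by (simp add: generator_graph_def)
  have "\<forall>\<^sub>F t in at_right 0. u t \<in> dirichlet_space"
    using gen_lim unfolding dirichlet_tendsto_def u_def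
    by (auto elim!: eventually_mono intro: dirichlet_space_diff)
  then have uD: "\<forall>\<^sub>F n in sequentially. u (\<tau> n) \<in> dirichlet_space"
    using \<tau>_lim by (rule eventually_compose_filterlim)
  have "((\<lambda>t. dirichlet_norm (u t)) \<longlongrightarrow> 0) (at_right 0)"
    using gen_lim unfolding dirichlet_tendsto_def u_def by auto
  then have norm_lim: "(\<lambda>n. dirichlet_norm (u (\<tau> n))) \<longlonglongrightarrow> 0"
    using \<tau>_lim by (rule filterlim_compose)
  have u_lim: "(\<lambda>n. u (\<tau> n) z) \<longlonglongrightarrow> v z" if z: "z \<in> \<bbbD>" for z
  proof -
    have "(\<lambda>n. (F (h z + of_real (\<tau> n)) - F (h z)) / of_real (\<tau> n)) \<longlonglongrightarrow> deriv F (h z)"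
      using difference_quotient_tendsto_at_right[OF F kp(3) h_in[OF z]] \<tau>_lim
      by (rule filterlim_compose)
    then show ?thesis
      using u_eq[OF z] \<tau>_pos unfolding v_def by (simp add: less_imp_le) (intro tendsto_intros)
  qed
  have du_lim: "(\<lambda>n. deriv (u (\<tau> n)) z) \<longlonglongrightarrow> deriv v z" if z: "z \<in> \<bbbD>" for z
  proof -
    have "(\<lambda>n. (deriv F (h z + of_real (\<tau> n)) - deriv F (h z)) / of_real (\<tau> n))
        \<longlonglongrightarrow> deriv (deriv F) (h z)"
      using difference_quotient_tendsto_at_right[OF F' kp(3) h_in[OF z]] \<tau>_lim
      by (rule filterlim_compose)
    then show ?thesis
      unfolding DERIV_imp_deriv[OF dv[OF z]] DERIV_imp_deriv[OF du[OF z \<tau>_pos]]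
      by (intro tendsto_intros)
  qed
  have "(\<integral>\<^sup>+z\<in>\<bbbD>. ennreal ((norm (deriv v z))\<^sup>2) \<partial>lborel)
    = (\<integral>\<^sup>+z. liminf (\<lambda>n. ennreal (indicator \<bbbD> z *\<^sub>R (norm (deriv (u (\<tau> n)) z))\<^sup>2)) \<partial>lborel)"
  proof (intro nn_integral_cong)
    fix z
    show "ennreal ((norm (deriv v z))\<^sup>2) * indicator \<bbbD> z
      = liminf (\<lambda>n. ennreal (indicator \<bbbD> z *\<^sub>R (norm (deriv (u (\<tau> n)) z))\<^sup>2))"
    proof (cases "z \<in> \<bbbD>")
      case True
      have "(\<lambda>n. ennreal ((norm (deriv (u (\<tau> n)) z))\<^sup>2)) \<longlonglongrightarrow> ennreal ((norm (deriv v z))\<^sup>2)"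
        by (intro tendsto_intros du_lim True)
      from lim_imp_Liminf[OF sequentially_bot this] True show ?thesis by simp
    qed (simp add: Liminf_const)
  qed
  also have "\<dots> \<le> liminf (\<lambda>n. \<integral>\<^sup>+z. ennreal (indicator \<bbbD> z *\<^sub>R (norm (deriv (u (\<tau> n)) z))\<^sup>2) \<partial>lborel)"
  proof (intro nn_integral_liminf)
    fix n
    have "continuous_on \<bbbD> (\<lambda>z. (norm (deriv (u (\<tau> n)) z))\<^sup>2)"
      using u_hol[OF \<tau>_pos]
      by (intro continuous_intros holomorphic_on_imp_continuous_on holomorphic_deriv) auto
    then have "(\<lambda>z. indicator \<bbbD> z *\<^sub>R (norm (deriv (u (\<tau> n)) z))\<^sup>2) \<in> borel_measurable borel"
      by (intro borel_measurable_continuous_on_indicator) auto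
    then show "(\<lambda>z. ennreal (indicator \<bbbD> z *\<^sub>R (norm (deriv (u (\<tau> n)) z))\<^sup>2)) \<in> borel_measurable lborel"
      by measurable
  qed
  also have "\<dots> \<le> liminf (\<lambda>n. ennreal (pi * (dirichlet_norm (u (\<tau> n)))\<^sup>2))"
  proof (intro Liminf_mono eventually_mono[OF uD])
    fix n assume "u (\<tau> n) \<in> dirichlet_space"
    then have "(\<integral>\<^sup>+z\<in>\<bbbD>. ennreal ((norm (deriv (u (\<tau> n)) z))\<^sup>2) \<partial>lborel)
        \<le> ennreal (pi * (dirichlet_norm (u (\<tau> n)))\<^sup>2)"
      by (rule dirichlet_norm_lower_bounds)
    moreover have "(\<integral>\<^sup>+z\<in>\<bbbD>. ennreal ((norm (deriv (u (\<tau> n)) z))\<^sup>2) \<partial>lborel)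
      = (\<integral>\<^sup>+z. ennreal (indicator \<bbbD> z *\<^sub>R (norm (deriv (u (\<tau> n)) z))\<^sup>2) \<partial>lborel)"
      by (intro nn_integral_cong) (auto simp: indicator_def)
    ultimately show "(\<integral>\<^sup>+z. ennreal (indicator \<bbbD> z *\<^sub>R (norm (deriv (u (\<tau> n)) z))\<^sup>2) \<partial>lborel)
      \<le> ennreal (pi * (dirichlet_norm (u (\<tau> n)))\<^sup>2)" by simp
  qed
  also have "\<dots> = 0"
  proof -
    have "(\<lambda>n. ennreal (pi * (dirichlet_norm (u (\<tau> n)))\<^sup>2)) \<longlonglongrightarrow> ennreal (pi * 0\<^sup>2)"
      by (intro tendsto_intros norm_lim)
    then show ?thesis by (simp add: lim_imp_Liminf)
  qed
  finally have "(\<integral>\<^sup>+z\<in>\<bbbD>. ennreal ((norm (deriv v z))\<^sup>2) \<partial>lborel) = 0" by simp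
  then have v'0: "deriv v z = 0" if "z \<in> \<bbbD>" for z
    using that v_hol
    by (intro continuous_eq_0_of_null_nn_integral[of \<bbbD> "deriv v"] holomorphic_on_imp_continuous_on holomorphic_deriv) auto
  have "v 0 = 0"
  proof (rule LIMSEQ_unique)
    show "(\<lambda>n. u (\<tau> n) 0) \<longlonglongrightarrow> v 0" by (rule u_lim) auto
    show "(\<lambda>n. u (\<tau> n) 0) \<longlonglongrightarrow> 0"
      by (rule Lim_null_comparison[OF eventually_mono[OF uD] norm_lim])
        (rule dirichlet_norm_lower_bounds)
  qed
  have v0: "v z = 0" if "z \<in> \<bbbD>" for z
  proof -
    have "\<exists>c. \<forall>z\<in>\<bbbD>. v z = c"
    proof (intro has_field_derivative_zero_constant convex_ball)
      fix z assume z: "z \<in> \<bbbD>"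
      have "(v has_field_derivative deriv v z) (at z)" by (rule holomorphic_derivI[OF v_hol open_ball z])
      then show "(v has_field_derivative 0) (at z within \<bbbD>)"
        using v'0[OF z] by (simp add: has_field_derivative_at_within)
    qed
    then show ?thesis using \<open>v 0 = 0\<close> that centre_in_ball[of 0 "1::real"] by fastforce
  qed
  \<comment> \<open>\<open>F\<close> solves \<open>F' = \<mu> F\<close>; dividing by the solution \<open>exp (\<mu> w)\<close> leaves a locally constant
     function on the connected set \<open>\<Omega>\<close>.\<close>
  define E where "E w = F w * exp (- \<mu> * w)" for w
  have "(E has_field_derivative 0) (at w)" if w: "w \<in> \<Omega>" for w
  proof -
    have ode: "deriv F w = \<mu> * F w" using v0 w by (auto simp: \<Omega>_def v_def)
    have "(E has_field_derivative (deriv F w * exp (- \<mu> * w) + F w * (exp (- \<mu> * w) * (- \<mu> * 1)))) (at w)"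
      unfolding E_def by (rule derivative_eq_intros dF w refl | simp)+
    then show ?thesis by (simp add: ode)
  qed
  note dE = this
  have "\<exists>c. \<forall>w\<in>\<Omega>. E w = c"
  proof -
    have "continuous_on \<Omega> E"
      using dE by (intro continuous_at_imp_continuous_on ballI) (rule DERIV_isCont)
    moreover have "\<forall>w\<in>\<Omega> - {}. (E has_field_derivative 0) (at w)"
      using dE by simp
    ultimately obtain c where "\<And>w. w \<in> \<Omega> \<Longrightarrow> E w = c"
      using DERIV_zero_connected_constant[OF kp(4,3) finite.emptyI, of E] by blast
    then show ?thesis by blast
  qed
  then obtain c where c: "\<And>w. w \<in> \<Omega> \<Longrightarrow> E w = c" by blast
  have "f z = c * exp (\<mu> * h z)" if z: "z \<in> \<bbbD>" for z
    using c[OF h_in[OF z]] Fh[OF z] by (auto simp: E_def exp_minus field_simps)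
  then show thesis by (rule that)
qed

text \<open>
  Composition with \<open>\<phi> t\<close> multiplies \<open>exp (\<mu> h)\<close> by the constant \<open>exp (\<mu> t)\<close>, so the norm limit
  in the definition of the generator is a limit of scalars.
\<close>

lemma exp_koenigs_eigenfunction:
  assumes sg: "disk_semigroup \<phi>" and k: "koenigs_function \<phi> h"
    and D: "(\<lambda>z. exp (\<mu> * h z)) \<in> dirichlet_space"
  shows "\<mu> \<in> point_spectrum \<phi>"
proof -
  define f where "f z = exp (\<mu> * h z)" for z
  have fD: "f \<in> dirichlet_space" using D by (simp add: f_def[abs_def])
  define q where "q t = (exp (\<mu> * of_real t) - 1) / of_real t" for t :: real
  have comp: "(comp_op \<phi> t f z - f z) / of_real t = q t * f z" if "z \<in> \<bbbD>" "t \<ge> 0" for t z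
    using k that by (auto simp: koenigs_function_def f_def q_def comp_op_def exp_add[symmetric] field_simps)
  have q_lim: "(q \<longlongrightarrow> \<mu>) (at_right 0)"
  proof -
    have "((\<lambda>w. exp (\<mu> * w)) has_field_derivative \<mu>) (at 0)"
      by (auto intro!: derivative_eq_intros)
    then have "deriv (\<lambda>w. exp (\<mu> * w)) 0 = \<mu>" by (rule DERIV_imp_deriv)
    moreover have "(\<lambda>w. exp (\<mu> * w)) holomorphic_on UNIV" by (intro holomorphic_intros)
    ultimately show ?thesis
      using difference_quotient_tendsto_at_right[of "\<lambda>w. exp (\<mu> * w)" UNIV 0]
      by (simp add: q_def[abs_def])
  qed
  have pos: "\<forall>\<^sub>F t::real in at_right 0. t > 0" by (rule eventually_at_right_less)
  have "dirichlet_tendsto (\<lambda>t z. (comp_op \<phi> t f z - f z) / of_real t) (\<lambda>z. \<mu> * f z) (at_right 0)"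
    unfolding dirichlet_tendsto_def
  proof (intro conjI)
    show "(\<lambda>z. \<mu> * f z) \<in> dirichlet_space" by (rule dirichlet_scaled(1)[OF fD, of _ \<mu>]) simp
    show "\<forall>\<^sub>F t in at_right 0. (\<lambda>z. (comp_op \<phi> t f z - f z) / of_real t) \<in> dirichlet_space"
      using pos by eventually_elim (auto intro!: dirichlet_scaled(1)[OF fD] comp)
    have "((\<lambda>t. norm (q t - \<mu>) * dirichlet_norm f) \<longlongrightarrow> norm (\<mu> - \<mu>) * dirichlet_norm f) (at_right 0)"
      by (intro tendsto_intros q_lim)
    then have lim: "((\<lambda>t. norm (q t - \<mu>) * dirichlet_norm f) \<longlongrightarrow> 0) (at_right 0)" by simp
    have "\<forall>\<^sub>F t in at_right 0. norm (q t - \<mu>) * dirichlet_norm f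
        = dirichlet_norm (\<lambda>z. (comp_op \<phi> t f z - f z) / of_real t - \<mu> * f z)"
      using pos
    proof eventually_elim
      case (elim t)
      show ?case using elim
        by (intro dirichlet_scaled(2)[OF fD, symmetric]) (simp add: comp left_diff_distrib)
    qed
    with lim show "((\<lambda>t. dirichlet_norm (\<lambda>z. (comp_op \<phi> t f z - f z) / of_real t - \<mu> * f z)) \<longlongrightarrow> 0) (at_right 0)"
      by (rule Lim_transform_eventually)
  qed
  with fD have "generator_graph \<phi> f (\<lambda>z. \<mu> * f z)" by (simp add: generator_graph_def)
  moreover have "\<exists>z\<in>\<bbbD>. f z \<noteq> 0" by (rule bexI[of _ 0]) (auto simp: f_def)
  ultimately show ?thesis by (auto simp: point_spectrum_def)
qed

lemma exp_koenigs_in_dirichlet_space_iff: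
  assumes k: "koenigs_function \<phi> h" and \<mu>: "\<mu> \<noteq> 0"
  shows "(\<lambda>z. exp (\<mu> * h z)) \<in> dirichlet_space \<longleftrightarrow>
    set_integrable lborel (h ` \<bbbD>) (\<lambda>w. exp (2 * Re (\<mu> * w)))"
proof -
  note kp = koenigs_function_properties[OF k]
  have der: "deriv (\<lambda>z. exp (\<mu> * h z)) z = exp (\<mu> * h z) * (\<mu> * deriv h z)" if "z \<in> \<bbbD>" for z
    using holomorphic_derivI[OF kp(1) _ that]
    by (intro DERIV_imp_deriv) (auto intro!: derivative_eq_intros)
  have sq: "(norm (exp w))\<^sup>2 = exp (2 * Re w)" for w :: complex
    by (simp only: norm_exp_eq_Re exp_double)
  have nder: "indicator \<bbbD> z * (norm (deriv (\<lambda>z. exp (\<mu> * h z)) z))\<^sup>2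
      = (norm \<mu>)\<^sup>2 * (indicator \<bbbD> z * ((norm (deriv h z))\<^sup>2 * exp (2 * Re (\<mu> * h z))))" for z
  proof (cases "z \<in> \<bbbD>")
    case True
    then show ?thesis
      by (simp only: der[OF True] indicator_simps norm_mult power_mult_distrib sq[of "\<mu> * h z"] mult_1 mult.left_commute mult.commute)
  qed simp
  have "(\<lambda>z. exp (\<mu> * h z)) holomorphic_on \<bbbD>" using kp(1) by (intro holomorphic_intros)
  then have "(\<lambda>z. exp (\<mu> * h z)) \<in> dirichlet_space \<longleftrightarrow>
      set_integrable lborel \<bbbD> (\<lambda>z. (norm (deriv h z))\<^sup>2 * exp (2 * Re (\<mu> * h z)))"
    unfolding dirichlet_space_def set_integrable_def using \<mu> by (simp add: nder)
  also have "\<dots> \<longleftrightarrow> set_integrable lborel (h ` \<bbbD>) (\<lambda>w. exp (2 * Re (\<mu> * w)))"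
    using kp by (intro set_integrable_holomorphic_change_of_variables[symmetric] continuous_intros) auto
  finally show ?thesis .
qed

theorem point_spectrum_iff_integrable:
  assumes sg: "disk_semigroup \<phi>" and k: "koenigs_function \<phi> h" and \<mu>: "\<mu> \<noteq> 0"
  shows "\<mu> \<in> point_spectrum \<phi> \<longleftrightarrow> set_integrable lborel (h ` \<bbbD>) (\<lambda>w. exp (2 * Re (\<mu> * w)))"
proof -
  have "(\<lambda>z. exp (\<mu> * h z)) \<in> dirichlet_space" if spec: "\<mu> \<in> point_spectrum \<phi>"
  proof -
    obtain f z0 where f: "z0 \<in> \<bbbD>" "f z0 \<noteq> 0" and gen: "generator_graph \<phi> f (\<lambda>z. \<mu> * f z)"
      using spec unfolding point_spectrum_def by (elim CollectE exE conjE bexE) (rule that)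
    obtain c where c: "\<And>z. z \<in> \<bbbD> \<Longrightarrow> f z = c * exp (\<mu> * h z)"
      using eigenfunction_is_exp[OF sg k gen] by blast
    with f have "c \<noteq> 0" by auto
    then have "exp (\<mu> * h z) = inverse c * f z" if "z \<in> \<bbbD>" for z using c[OF that] by simp
    moreover have "f \<in> dirichlet_space" using gen by (simp add: generator_graph_def)
    ultimately show ?thesis by (rule dirichlet_scaled(1)[rotated])
  qed
  then show ?thesis
    using exp_koenigs_eigenfunction[OF sg k] exp_koenigs_in_dirichlet_space_iff[OF k \<mu>] by blast
qed

text \<open>
  The eigenfunctions for the eigenvalue \<open>0\<close> are the constants.
\<close>

lemma zero_in_point_spectrum:
  assumes "disk_semigroup \<phi>" "koenigs_function \<phi> h"
  shows "0 \<in> point_spectrum \<phi>"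
  using exp_koenigs_eigenfunction[OF assms, of 0] by (simp add: dirichlet_space_def set_integrable_def)

section \<open>Integrability of exponentials on planar domains\<close>

lemma integrable_exp_minus_abs:
  fixes c :: real assumes "c > 0" shows "integrable lborel (\<lambda>x. exp (-c * \<bar>x\<bar>))"
proof -
  have "(\<lambda>x. exp (-c * x)) integrable_on {0..}"
    using has_integral_exp_minus_to_infinity[OF assms] by blast
  then have "(\<lambda>x. exp (-c * x)) absolutely_integrable_on {0..}"
    by (rule nonnegative_absolutely_integrable_1) auto
  then have *: "integrable lborel (\<lambda>x. indicator {0..} x *\<^sub>R exp (-c * x))"
    unfolding set_integrable_def by (subst (asm) integrable_completion) auto
  have "integrable lborel (\<lambda>x. indicator {0..} (0 + (-1) * x) *\<^sub>R exp (-c * (0 + (-1) * x)))"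
    using lborel_integrable_real_affine[OF *, of "-1" 0] by auto
  with * have "integrable lborel (\<lambda>x. indicator {0..} x *\<^sub>R exp (-c * x)
    + indicator {0..} (0 + (-1) * x) *\<^sub>R exp (-c * (0 + (-1) * x)))"
    by (rule Bochner_Integration.integrable_add)
  then show ?thesis
    by (rule Bochner_Integration.integrable_bound) (auto simp: indicator_def)
qed

text \<open>
  Each coordinate is bounded by the norm, so \<open>exp (-c * norm x)\<close> is dominated by a product of
  one-variable exponentials with rate \<open>c\<close> divided by the dimension.
\<close>

lemma integrable_exp_minus_norm:
  fixes c :: real assumes "c > 0"
  shows "integrable lborel (\<lambda>x::'a::euclidean_space. exp (-c * norm x))"
proof -
  define d where "d = c / DIM('a)"
  have d: "d > 0" using assms by (simp add: d_def)
  have "(\<integral>\<^sup>+x. ennreal (exp (- d * \<bar>x\<bar>)) \<partial>lborel) < \<infinity>"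
    using integrable_exp_minus_abs[OF d] by (auto simp: integrable_iff_bounded)
  then have "(\<integral>\<^sup>+(x::'a). (\<Prod>b\<in>Basis. ennreal (exp (- d * \<bar>x \<bullet> b\<bar>))) \<partial>lborel) < \<infinity>"
    using nn_integral_lborel_prod[where 'a='a and f="\<lambda>b x. exp (- d * \<bar>x\<bar>)"]
    by (simp add: prod_ennreal less_top ennreal_prod_eq_top power_less_top_ennreal)
  moreover have "(\<integral>\<^sup>+(x::'a). ennreal (norm (exp (-c * norm x))) \<partial>lborel)
      \<le> (\<integral>\<^sup>+(x::'a). (\<Prod>b\<in>Basis. ennreal (exp (- d * \<bar>x \<bullet> b\<bar>))) \<partial>lborel)"
  proof (intro nn_integral_mono)
    fix x :: 'a
    have "(\<Sum>b\<in>Basis. \<bar>x \<bullet> b\<bar>) \<le> (\<Sum>b\<in>(Basis::'a set). norm x)"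
      by (intro sum_mono Basis_le_norm)
    then have "d * (\<Sum>b\<in>Basis. \<bar>x \<bullet> b\<bar>) \<le> d * (DIM('a) * norm x)"
      using d by (intro mult_left_mono) auto
    also have "\<dots> = c * norm x" by (simp add: d_def)
    finally have "exp (- c * norm x) \<le> exp (\<Sum>b\<in>Basis. - d * \<bar>x \<bullet> b\<bar>)"
      by (simp add: sum_distrib_left sum_negf)
    then show "ennreal (norm (exp (-c * norm x))) \<le> (\<Prod>b\<in>Basis. ennreal (exp (- d * \<bar>x \<bullet> b\<bar>)))"
      by (simp add: prod_ennreal exp_sum ennreal_leI)
  qed
  ultimately show ?thesis
    unfolding integrable_iff_bounded by (auto intro: le_less_trans)
qed

lemma sector_oo_0_iff:
  "w \<in> sector_oo 0 \<theta> \<longleftrightarrow> (\<exists>r \<alpha>. r > 0 \<and> 0 < \<alpha> \<and> \<alpha> < \<theta> \<and> \<alpha> \<le> pi \<and> w = rcis r \<alpha>)" (is "?L \<longleftrightarrow> ?R")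
proof
  assume ?L
  then have "w \<noteq> 0" "0 < Arg w" "Arg w < \<theta>" by (auto simp: sector_oo_def)
  then show ?R
    using Arg_le_pi[of w] rcis_cmod_Arg[of w] by (intro exI[of _ "norm w"] exI[of _ "Arg w"]) auto
next
  assume ?R
  then obtain r \<alpha> where *: "r > 0" "0 < \<alpha>" "\<alpha> < \<theta>" "\<alpha> \<le> pi" "w = rcis r \<alpha>" by blast
  then have "Arg w = \<alpha>"
    by (intro Arg_unique[of r]) (auto simp: rcis_def cis_conv_exp)
  with * show ?L by (auto simp: sector_oo_def)
qed

lemma open_sector_oo_0:
  assumes "\<theta> \<le> pi" shows "open (sector_oo 0 \<theta>)"
proof -
  have "open {w. Im w > 0}" by (rule open_halfspace_Im_gt)
  moreover have "continuous_on {w. Im w > 0} Arg"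
    by (intro continuous_at_imp_continuous_on ballI continuous_at_Arg)
      (auto simp: complex_nonpos_Reals_iff)
  ultimately have "open ({w. Im w > 0} \<inter> Arg -` {..<\<theta>})"
    by (intro continuous_open_preimage) auto
  also have "{w. Im w > 0} \<inter> Arg -` {..<\<theta>} = sector_oo 0 \<theta>"
    using assms by (auto simp: sector_oo_def Arg_lt_pi[symmetric] Arg_zero)
  finally show ?thesis .
qed

lemma sector_oo_scale:
  assumes "w \<in> sector_oo a b" "r > 0" shows "of_real r * w \<in> sector_oo a b"
  using assms by (auto simp: sector_oo_def)

text \<open>
  For \<open>w - q\<close> of modulus \<open>r\<close> and argument \<open>\<alpha>\<close>, the exponent is up to a constant
  \<open>-2 * norm \<mu> * r * sin (Arg \<mu> + \<alpha>)\<close>, and the sine has a positive minimum on the compact interval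
  \<open>[Arg \<mu>, Arg \<mu> + \<theta>]\<close>, which lies inside \<open>(0, \<pi>)\<close>.
\<close>

lemma set_integrable_exp_on_sector:
  assumes \<mu>: "\<mu> \<noteq> 0" "0 < Arg \<mu>" "Arg \<mu> + \<theta> < pi" and \<theta>: "0 < \<theta>"
    and U: "open U" "U \<subseteq> (+) q ` sector_oo 0 \<theta>"
  shows "set_integrable lborel U (\<lambda>w. exp (2 * Re (\<i> * \<mu> * w)))"
proof -
  have "\<exists>\<beta>\<in>{Arg \<mu>..Arg \<mu> + \<theta>}. \<forall>x\<in>{Arg \<mu>..Arg \<mu> + \<theta>}. sin \<beta> \<le> sin x"
    using \<theta> by (intro continuous_attains_inf continuous_intros) auto
  then obtain \<beta> where \<beta>: "\<beta> \<in> {Arg \<mu>..Arg \<mu> + \<theta>}"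
    and min: "\<And>x. x \<in> {Arg \<mu>..Arg \<mu> + \<theta>} \<Longrightarrow> sin \<beta> \<le> sin x"
    by blast
  have "sin \<beta> > 0" using \<beta> \<mu> by (intro sin_gt_zero) auto
  define c where "c = 2 * norm \<mu> * sin \<beta>"
  have c: "c > 0" using \<mu> \<open>sin \<beta> > 0\<close> by (simp add: c_def)
  define C where "C = exp (2 * Re (\<i> * \<mu> * q))"
  have bound: "exp (2 * Re (\<i> * \<mu> * w)) \<le> C * exp (- c * norm (w - q))" if wU: "w \<in> U" for w
  proof -
    obtain v where v: "v \<in> sector_oo 0 \<theta>" "w = q + v" using subsetD[OF U(2) wU] by (elim imageE)
    obtain r \<alpha> where r: "r > 0" "0 < \<alpha>" "\<alpha> < \<theta>" and "v = rcis r \<alpha>"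
      using v(1) unfolding sector_oo_0_iff by blast
    then have w: "w = q + rcis r \<alpha>" using v(2) by simp
    have "\<mu> * rcis r \<alpha> = rcis (norm \<mu> * r) (Arg \<mu> + \<alpha>)"
      using rcis_mult[of "norm \<mu>" "Arg \<mu>" r \<alpha>] by (simp add: rcis_cmod_Arg)
    then have "Re (\<i> * (\<mu> * rcis r \<alpha>)) = - (norm \<mu> * r * sin (Arg \<mu> + \<alpha>))"
      by simp
    moreover have "norm \<mu> * r * sin \<beta> \<le> norm \<mu> * r * sin (Arg \<mu> + \<alpha>)"
      using r by (intro mult_left_mono min) auto
    ultimately have "2 * Re (\<i> * (\<mu> * rcis r \<alpha>)) \<le> - c * r" by (simp add: c_def algebra_simps)
    moreover have "\<i> * \<mu> * w = \<i> * \<mu> * q + \<i> * (\<mu> * rcis r \<alpha>)" by (simp add: w algebra_simps)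
    then have "2 * Re (\<i> * \<mu> * w) = 2 * Re (\<i> * \<mu> * q) + 2 * Re (\<i> * (\<mu> * rcis r \<alpha>))"
      by (simp only: plus_complex.sel distrib_left)
    moreover have "norm (w - q) = r" using r w by simp
    ultimately show ?thesis by (simp add: C_def exp_add[symmetric])
  qed
  have "integrable lborel (\<lambda>w::complex. exp (- c * norm w))" using integrable_exp_minus_norm[OF c] .
  then have "integrable (distr lborel borel ((+) (- q))) (\<lambda>w::complex. exp (- c * norm w))"
    by (simp add: lborel_distr_plus)
  then have "integrable lborel (\<lambda>w::complex. exp (- c * norm (- q + w)))"
    by (subst (asm) integrable_distr_eq) auto
  then have "integrable lborel (\<lambda>w. C * exp (- c * norm (w - q)))" by simp
  then have "set_integrable lborel U (\<lambda>w. C * exp (- c * norm (w - q)))"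
    using U(1) unfolding set_integrable_def by (intro integrable_mult_indicator) auto
  then show ?thesis
  proof (rule set_integrable_bound)
    show "set_borel_measurable lborel U (\<lambda>w. exp (2 * Re (\<i> * \<mu> * w)))"
      using U(1) unfolding set_borel_measurable_def measurable_lborel2
      by (intro borel_measurable_continuous_on_indicator continuous_intros) auto
    show "AE w in lborel. w \<in> U \<longrightarrow> norm (exp (2 * Re (\<i> * \<mu> * w))) \<le> norm (C * exp (- c * norm (w - q)))"
      using bound by (intro AE_I2) (auto simp: C_def)
  qed
qed

text \<open>
  The centres \<open>a + 2 r n e\<close> are spaced so that the discs of radius \<open>r\<close> are disjoint. If
  \<open>Im (\<mu> e) \<le> 0\<close>, moving along \<open>e\<close> does not decrease the integrand, so a positive lower bound on the
  first disc persists on all of them, and they have infinite total area.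
\<close>

lemma Im_pos_of_set_integrable_exp:
  assumes int: "set_integrable lborel U (\<lambda>w. exp (2 * Re (\<i> * \<mu> * w)))"
    and e: "norm e = 1" and r: "r > 0"
    and balls: "\<And>n::nat. ball (a + of_real (2 * r * real n) * e) r \<subseteq> U"
  shows "Im (\<mu> * e) > 0"
proof (rule ccontr)
  assume "\<not> Im (\<mu> * e) > 0"
  then have neg: "Im (\<mu> * e) \<le> 0" by simp
  define B where "B n = ball (a + of_real (2 * r * real n) * e) r" for n :: nat
  define m where "m = exp (- 2 * (Im (\<mu> * a) + norm \<mu> * r))"
  have Im_scale: "Im (of_real x * z) = x * Im z" for x z by simp
  have low: "exp (2 * Re (\<i> * \<mu> * w)) \<ge> m" if "w \<in> B n" for w n
  proof -
    define d where "d = w - (a + of_real (2 * r * real n) * e)"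
    have d: "norm d < r" using that by (simp add: d_def B_def dist_norm norm_minus_commute)
    have "\<mu> * w = \<mu> * a + of_real (2 * r * real n) * (\<mu> * e) + \<mu> * d"
      by (simp add: d_def algebra_simps)
    then have "Im (\<mu> * w) = Im (\<mu> * a) + 2 * r * real n * Im (\<mu> * e) + Im (\<mu> * d)"
      by (simp only: plus_complex.sel Im_scale)
    moreover have "2 * r * real n * Im (\<mu> * e) \<le> 0"
      using r neg by (intro mult_nonneg_nonpos) auto
    moreover have "Im (\<mu> * d) \<le> norm \<mu> * r"
      using abs_Im_le_cmod[of "\<mu> * d"] mult_left_mono[OF less_imp_le[OF d], of "norm \<mu>"]
      by (simp add: norm_mult)
    ultimately show ?thesis by (simp add: m_def)
  qed
  have disj: "disjoint_family B"
    unfolding disjoint_family_on_def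
  proof (intro ballI impI)
    fix k n :: nat assume "k \<noteq> n"
    have "1 \<le> \<bar>real k - real n\<bar>" using \<open>k \<noteq> n\<close> by linarith
    then have "2 * r * 1 \<le> 2 * r * \<bar>real k - real n\<bar>" using r by (intro mult_left_mono) auto
    moreover have "dist (a + of_real (2 * r * real k) * e) (a + of_real (2 * r * real n) * e)
        = norm (of_real (2 * r * (real k - real n)) * e)"
      by (simp add: dist_norm algebra_simps)
    ultimately have "2 * r \<le> dist (a + of_real (2 * r * real k) * e) (a + of_real (2 * r * real n) * e)"
      using r e by (simp add: norm_mult abs_mult del: of_real_mult of_real_diff)
    then show "B k \<inter> B n = {}" unfolding B_def by (intro disjoint_ballI) simp
  qed
  have meas: "range B \<subseteq> sets lborel" by (auto simp: B_def)
  have "(\<integral>\<^sup>+w. ennreal m * indicator (\<Union>n. B n) w \<partial>lborel)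
      \<le> (\<integral>\<^sup>+w. ennreal (norm (indicator U w *\<^sub>R exp (2 * Re (\<i> * \<mu> * w)))) \<partial>lborel)"
  proof (intro nn_integral_mono)
    fix w
    show "ennreal m * indicator (\<Union>n. B n) w \<le> ennreal (norm (indicator U w *\<^sub>R exp (2 * Re (\<i> * \<mu> * w))))"
    proof (cases "w \<in> (\<Union>n. B n)")
      case True
      then obtain n where n: "w \<in> B n" by blast
      then have "w \<in> U" using balls[of n] by (auto simp: B_def)
      with True low[OF n] show ?thesis by (simp add: ennreal_leI)
    qed simp
  qed
  also have "\<dots> < \<infinity>"
    using int unfolding set_integrable_def integrable_iff_bounded by blast
  finally have "ennreal m * emeasure lborel (\<Union>n. B n) < \<infinity>"
    using meas by (subst (asm) nn_integral_cmult_indicator) auto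
  moreover have "emeasure lborel (\<Union>n. B n) = \<infinity>"
  proof -
    have "emeasure lborel (\<Union>n. B n) = (\<Sum>n. emeasure lborel (B n))"
      using suminf_emeasure[OF meas disj] by simp
    also have "\<dots> = (\<Sum>n::nat. ennreal (pi * r\<^sup>2))"
      using r by (intro suminf_cong) (simp add: B_def emeasure_ball unit_ball_vol_2)
    also have "\<dots> = \<infinity>"
    proof (rule ccontr)
      assume "(\<Sum>n::nat. ennreal (pi * r\<^sup>2)) \<noteq> \<infinity>"
      then have "summable (\<lambda>n::nat. pi * r\<^sup>2)" by (intro summable_suminf_not_top) auto
      then show False using r by (simp only: summable_const_iff) simp
    qed
    finally show ?thesis .
  qed
  moreover have "m > 0" by (simp add: m_def)
  ultimately show False by (simp add: ennreal_mult_top)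
qed

lemma Im_pos_of_set_integrable_exp_horizontal:
  assumes U: "open U" "U \<noteq> {}" "\<And>w t. w \<in> U \<Longrightarrow> t \<ge> 0 \<Longrightarrow> w + of_real t \<in> U"
    and int: "set_integrable lborel U (\<lambda>w. exp (2 * Re (\<i> * \<mu> * w)))"
  shows "Im \<mu> > 0"
proof -
  obtain a r where r: "r > 0" "ball a r \<subseteq> U" using U(1,2) openE by blast
  have "Im (\<mu> * 1) > 0"
  proof (rule Im_pos_of_set_integrable_exp[OF int _ r(1)])
    fix n :: nat
    show "ball (a + of_real (2 * r * real n) * 1) r \<subseteq> U"
    proof
      fix w assume "w \<in> ball (a + of_real (2 * r * real n) * 1) r"
      then have "w - of_real (2 * r * real n) \<in> ball a r" by (simp add: dist_norm algebra_simps)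
      then have "w - of_real (2 * r * real n) + of_real (2 * r * real n) \<in> U"
        using r by (intro U(3)) auto
      then show "w \<in> U" by simp
    qed
  qed simp
  then show ?thesis by simp
qed

text \<open>
  A sector contains, with a disc around \<open>e\<^sup>i\<^sup>\<alpha>\<close>, every translate of that disc in the direction
  \<open>e\<^sup>i\<^sup>\<alpha>\<close>: the translate by \<open>(k - 1) e\<^sup>i\<^sup>\<alpha>\<close> lies in the dilation of the disc by \<open>k \<ge> 1\<close>.
\<close>

lemma Arg_add_le_pi_of_set_integrable_exp:
  assumes int: "set_integrable lborel U (\<lambda>w. exp (2 * Re (\<i> * \<mu> * w)))"
    and U: "(+) q ` sector_oo 0 \<theta> \<subseteq> U" and \<theta>: "\<theta> \<le> pi" and \<mu>: "Im \<mu> > 0"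
  shows "Arg \<mu> + \<theta> \<le> pi"
proof -
  have Arg: "0 < Arg \<mu>" "Arg \<mu> < pi" using \<mu> Arg_lt_pi by auto
  have "Arg \<mu> + \<alpha> < pi" if \<alpha>: "0 < \<alpha>" "\<alpha> < \<theta>" for \<alpha>
  proof -
    have "rcis 1 \<alpha> \<in> sector_oo 0 \<theta>"
      unfolding sector_oo_0_iff using \<alpha> \<theta> by (intro exI[of _ 1] exI[of _ \<alpha>]) auto
    then have "cis \<alpha> \<in> sector_oo 0 \<theta>" by (simp add: rcis_def)
    then obtain r where r: "r > 0" "ball (cis \<alpha>) r \<subseteq> sector_oo 0 \<theta>"
      using open_sector_oo_0[OF \<theta>] openE by blast
    have "Im (\<mu> * cis \<alpha>) > 0"
    proof (rule Im_pos_of_set_integrable_exp[OF int _ r(1), of _ "q + cis \<alpha>"])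
      fix n :: nat
      show "ball (q + cis \<alpha> + of_real (2 * r * real n) * cis \<alpha>) r \<subseteq> U"
      proof
        fix w assume w: "w \<in> ball (q + cis \<alpha> + of_real (2 * r * real n) * cis \<alpha>) r"
        define k where "k = 1 + 2 * r * real n"
        have k: "k \<ge> 1" using r by (simp add: k_def)
        then have k0: "complex_of_real k \<noteq> 0" by auto
        then have kq: "of_real k * ((w - q) / of_real k) = w - q" by simp
        have "norm (w - q - of_real k * cis \<alpha>) < r"
          using w by (simp add: dist_norm k_def algebra_simps norm_minus_commute)
        moreover have "of_real k * ((w - q) / of_real k - cis \<alpha>) = w - q - of_real k * cis \<alpha>"
          by (simp only: right_diff_distrib kq)
        ultimately have "k * norm ((w - q) / of_real k - cis \<alpha>) < r"
          using k by (metis norm_mult norm_of_real abs_of_nonneg order.trans zero_le_one)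
        moreover have "1 * norm ((w - q) / of_real k - cis \<alpha>) \<le> k * norm ((w - q) / of_real k - cis \<alpha>)"
          using k by (intro mult_right_mono) auto
        ultimately have "(w - q) / of_real k \<in> sector_oo 0 \<theta>"
          using r(2) by (intro subsetD[OF r(2)]) (simp add: dist_norm norm_minus_commute)
        then have "of_real k * ((w - q) / of_real k) \<in> sector_oo 0 \<theta>"
          using k by (intro sector_oo_scale) auto
        then have "w - q \<in> sector_oo 0 \<theta>" by (simp only: kq)
        then have "q + (w - q) \<in> U" using U by blast
        then show "w \<in> U" by simp
      qed
    qed simp
    moreover have "\<mu> * cis \<alpha> = rcis (norm \<mu>) (Arg \<mu> + \<alpha>)"
      using rcis_mult[of "norm \<mu>" "Arg \<mu>" 1 \<alpha>] by (simp add: rcis_cmod_Arg rcis_def[of 1])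
    ultimately have "sin (Arg \<mu> + \<alpha>) > 0"
      by (simp add: zero_less_mult_iff)
    show ?thesis
    proof (rule ccontr)
      assume "\<not> Arg \<mu> + \<alpha> < pi"
      then have "sin (Arg \<mu> + \<alpha>) \<le> 0" using Arg \<alpha> \<theta> by (intro sin_le_zero) auto
      with \<open>sin (Arg \<mu> + \<alpha>) > 0\<close> show False by simp
    qed
  qed
  \<comment> \<open>The direction \<open>\<alpha> = \<pi> - Arg \<mu>\<close>, in which \<open>\<mu> e\<^sup>i\<^sup>\<alpha>\<close> is a negative real number, is excluded.\<close>
  from this[of "pi - Arg \<mu>"] Arg have "\<not> pi - Arg \<mu> < \<theta>" by auto
  then show ?thesis by simp
qed

section \<open>Inclusions for the point spectrum\<close>

theorem theorem1p3:
  fixes \<phi> :: "real \<Rightarrow> complex \<Rightarrow> complex"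
    and h :: "complex \<Rightarrow> complex"
    and \<Omega> :: "complex set"
  assumes "parabolic \<phi>"
    and "positive_hyperbolic_step \<phi>"
    and "koenigs_function \<phi> h"
    and "\<Omega> = h ` \<bbbD>"
    and "\<Omega> \<subseteq> sector_oo 0 pi"
  shows
    "(inner_argument \<Omega> = 0 \<and> outer_argument \<Omega> = 0 \<longrightarrow>
        point_spectrum \<phi> = (*) \<i> ` sector_oo 0 pi \<union> {0}) \<and>
     (inner_argument \<Omega> = outer_argument \<Omega> \<and> 0 < inner_argument \<Omega> \<and> inner_argument \<Omega> < pi \<longrightarrow>
        (*) \<i> ` sector_oo 0 (pi - inner_argument \<Omega>) \<union> {0} \<subseteq> point_spectrum \<phi> \<and>
        point_spectrum \<phi> \<subseteq> (*) \<i> ` sector_oc 0 (pi - inner_argument \<Omega>) \<union> {0}) \<and>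
     (inner_argument \<Omega> = pi \<and> outer_argument \<Omega> = pi \<longrightarrow>
        point_spectrum \<phi> = {0}) \<and>
     (inner_argument \<Omega> < outer_argument \<Omega> \<longrightarrow>
        (if outer_argument \<Omega> = pi then {0}
         else (*) \<i> ` sector_oo 0 (pi - outer_argument \<Omega>) \<union> {0}) \<subseteq> point_spectrum \<phi> \<and>
        point_spectrum \<phi> \<subseteq>
          (if inner_argument \<Omega> = 0 then (*) \<i> ` sector_oo 0 pi \<union> {0}
           else (*) \<i> ` sector_oc 0 (pi - inner_argument \<Omega>) \<union> {0}))"
proof -
  have sg: "disk_semigroup \<phi>"
    using assms(1) by (simp add: parabolic_def non_elliptic_def)
  note k = assms(3)
  note kp = koenigs_function_properties[OF k, folded assms(4)]
  have zero: "0 \<in> point_spectrum \<phi>" by (rule zero_in_point_spectrum[OF sg k])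
  have crit: "\<i> * \<mu> \<in> point_spectrum \<phi> \<longleftrightarrow> set_integrable lborel \<Omega> (\<lambda>w. exp (2 * Re (\<i> * \<mu> * w)))"
    if "\<mu> \<noteq> 0" for \<mu>
    unfolding assms(4) using that by (intro point_spectrum_iff_integrable[OF sg k]) auto
  have lower: "(*) \<i> ` sector_oo 0 (pi - outer_argument \<Omega>) \<union> {0} \<subseteq> point_spectrum \<phi>"
  proof -
    have "\<i> * \<mu> \<in> point_spectrum \<phi>" if "\<mu> \<in> sector_oo 0 (pi - outer_argument \<Omega>)" for \<mu>
    proof -
      define T where "T = {\<theta>. 0 < \<theta> \<and> \<theta> \<le> pi \<and> (\<exists>q. \<Omega> \<subseteq> (+) q ` sector_oo 0 \<theta>)}"
      have "pi \<in> T" using assms(5) by (auto simp: T_def intro!: exI[of _ 0])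
      moreover have "Inf T < pi - Arg \<mu>"
        using that by (simp add: sector_oo_def outer_argument_def T_def)
      ultimately obtain \<theta> where \<theta>: "\<theta> \<in> T" "\<theta> < pi - Arg \<mu>"
        using cInf_lessD[of T] by blast
      then obtain q where q: "0 < \<theta>" "\<Omega> \<subseteq> (+) q ` sector_oo 0 \<theta>" by (auto simp: T_def)
      have \<mu>: "\<mu> \<noteq> 0" "0 < Arg \<mu>" using that by (auto simp: sector_oo_def)
      have "Arg \<mu> + \<theta> < pi" using \<theta>(2) by simp
      from set_integrable_exp_on_sector[OF \<mu> this q(1) kp(3) q(2)] show ?thesis
        by (simp only: crit[OF \<mu>(1)])
    qed
    then show ?thesis using zero by auto
  qed
  have upper: "0 < Arg \<mu> \<and> Arg \<mu> < pi \<and> Arg \<mu> \<le> pi - inner_argument \<Omega>"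
    if spec: "\<i> * \<mu> \<in> point_spectrum \<phi>" and "\<mu> \<noteq> 0" for \<mu>
  proof -
    from spec have int: "set_integrable lborel \<Omega> (\<lambda>w. exp (2 * Re (\<i> * \<mu> * w)))"
      by (simp only: crit[OF \<open>\<mu> \<noteq> 0\<close>])
    have "\<Omega> \<noteq> {}" using assms(4) by simp
    then have im: "Im \<mu> > 0"
      by (intro Im_pos_of_set_integrable_exp_horizontal[OF kp(3) _ koenigs_domain_translate[OF sg k, folded assms(4)] int])
    then have Arg: "0 < Arg \<mu>" "Arg \<mu> < pi" using Arg_lt_pi by auto
    have "inner_argument \<Omega> \<le> pi - Arg \<mu>"
      unfolding inner_argument_def
    proof (rule cSup_least)
      fix \<theta> assume "\<theta> \<in> {0} \<union> {\<theta>. 0 < \<theta> \<and> \<theta> \<le> pi \<and> (\<exists>q. (+) q ` sector_oo 0 \<theta> \<subseteq> \<Omega>)}"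
      then consider "\<theta> = 0" | q where "\<theta> \<le> pi" "(+) q ` sector_oo 0 \<theta> \<subseteq> \<Omega>" by blast
      then show "\<theta> \<le> pi - Arg \<mu>"
      proof cases
        case 1
        then show ?thesis using Arg by simp
      next
        case 2
        then show ?thesis using Arg_add_le_pi_of_set_integrable_exp[OF int 2(2,1) im] by simp
      qed
    qed simp
    with Arg show "0 < Arg \<mu> \<and> Arg \<mu> < pi \<and> Arg \<mu> \<le> pi - inner_argument \<Omega>" by simp
  qed
  have upper_oo: "point_spectrum \<phi> \<subseteq> (*) \<i> ` sector_oo 0 pi \<union> {0}"
    and upper_oc: "point_spectrum \<phi> \<subseteq> (*) \<i> ` sector_oc 0 (pi - inner_argument \<Omega>) \<union> {0}"
  proof -
    have "\<nu> \<in> (*) \<i> ` sector_oo 0 pi \<union> {0} \<and> \<nu> \<in> (*) \<i> ` sector_oc 0 (pi - inner_argument \<Omega>) \<union> {0}"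
      if "\<nu> \<in> point_spectrum \<phi>" for \<nu>
    proof -
      define \<mu> where "\<mu> = - \<i> * \<nu>"
      have "\<nu> = \<i> * \<mu>" by (simp add: \<mu>_def)
      moreover have "\<mu> = 0 \<or> \<mu> \<in> sector_oo 0 pi \<and> \<mu> \<in> sector_oc 0 (pi - inner_argument \<Omega>)"
        using upper[of \<mu>] that \<open>\<nu> = \<i> * \<mu>\<close> by (cases "\<mu> = 0") (simp_all add: sector_oo_def sector_oc_def)
      ultimately show ?thesis by auto
    qed
    then show "point_spectrum \<phi> \<subseteq> (*) \<i> ` sector_oo 0 pi \<union> {0}"
      "point_spectrum \<phi> \<subseteq> (*) \<i> ` sector_oc 0 (pi - inner_argument \<Omega>) \<union> {0}" by blast+
  qed
  have oc0: "sector_oc 0 0 = {}" by (auto simp: sector_oc_def)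
  show ?thesis
  proof (intro conjI impI)
    assume "inner_argument \<Omega> = 0 \<and> outer_argument \<Omega> = 0"
    then show "point_spectrum \<phi> = (*) \<i> ` sector_oo 0 pi \<union> {0}"
      using lower upper_oo by (simp add: subset_antisym)
  next
    assume "inner_argument \<Omega> = pi \<and> outer_argument \<Omega> = pi"
    then show "point_spectrum \<phi> = {0}"
      using upper_oc zero by (simp add: oc0 subset_antisym)
  next
    assume "inner_argument \<Omega> = outer_argument \<Omega> \<and> 0 < inner_argument \<Omega> \<and> inner_argument \<Omega> < pi"
    then show "(*) \<i> ` sector_oo 0 (pi - inner_argument \<Omega>) \<union> {0} \<subseteq> point_spectrum \<phi>"
      using lower by simp
  next
    show "(if outer_argument \<Omega> = pi then {0}
         else (*) \<i> ` sector_oo 0 (pi - outer_argument \<Omega>) \<union> {0}) \<subseteq> point_spectrum \<phi>"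
      using lower zero by simp
  next
    show "point_spectrum \<phi> \<subseteq>
          (if inner_argument \<Omega> = 0 then (*) \<i> ` sector_oo 0 pi \<union> {0}
           else (*) \<i> ` sector_oc 0 (pi - inner_argument \<Omega>) \<union> {0})"
      using upper_oo upper_oc by simp
  qed (rule upper_oc)
qed

end
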